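(* Let $B=(b_{ij})_{n\times n}$ be a connected skew-symmetrizable integer matrix. Then $B$ is irreducible if and only if each arrow of the quiver $\Gamma(B)$ lies in some oriented cycle of $\Gamma(B)$.
   Context: An $n\times n$ integer matrix $B$ is skew-symmetrizable if there is a diagonal matrix $S$ with positive integer diagonal entries such that $SB$ is skew-symmetric. The underlying quiver $\Gamma(B)$ of a skew-symmetrizable matrix $B=(b_{ij})_{n\times n}$ has vertices $1,\dots,n$ and an arrow $i\to j$ whenever $b_{ij}>0$. $B$ is connected if $\Gamma(B)$ is a connected quiver (i.e. its underlying undirected graph is connected). For positive integers $n_1,n_2$, and for $1\le i_1<\cdots<i_{n_2}\le n$, $1\le j_1<\cdots<j_{n_1}\le n$, let $B^{i_1,\dots,i_{n_2}}_{j_1,\dots,j_{n_1}}$ be the submatrix of $B$ with entries $b_{ij}$, $i\in\{i_1,\dots,i_{n_2}\}$, $j\in\{j_1,\dots,j_{n_1}\}$. It is proper if $n_1<n$ or $n_2<n$. A skew-symmetrizable matrix $B$ is reducible if it has a proper submatrix $B^{i_1,\dots,i_{n_2}}_{j_1,\dots,j_{n_1}}$ (with $n_1,n_2\ge 1$) such that all entries of this submatrix are nonnegative, $\{i_1,\dots,i_{n_2}\}\cup\{j_1,\dots,j_{n_1}\}=\{1,\dots,n\}$ and $\{i_1,\dots,i_{n_2}\}\cap\{j_1,\dots,j_{n_1}\}=\emptyset$. Otherwise $B$ is irreducible. *)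

theory Defs
  imports
    "Jordan_Normal_Form.DL_Submatrix"
    "Graph_Theory.Digraph_Component"
begin

text \<open>Matrix indices, and hence quiver vertices, are numbered \<open>0, \<dots>, n - 1\<close>,
  following the convention of \<^typ>\<open>int mat\<close>.\<close>

definition skew_symmetric_mat :: "int mat \<Rightarrow> bool" where
  "skew_symmetric_mat A \<longleftrightarrow> square_mat A \<and> transpose_mat A = - A"

definition skew_symmetrizable_mat :: "int mat \<Rightarrow> bool" where
  "skew_symmetrizable_mat B \<longleftrightarrow> square_mat B \<and>
     (\<exists>S \<in> carrier_mat (dim_row B) (dim_row B).
        diagonal_mat S \<and> (\<forall>i < dim_row B. S $$ (i, i) > 0) \<and> skew_symmetric_mat (S * B))"

text \<open>Each pair \<open>(i, j)\<close> with \<open>b\<^sub>i\<^sub>j > 0\<close> contributes exactly one arrow,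
  whatever the value of \<open>b\<^sub>i\<^sub>j\<close>.\<close>

definition underlying_quiver :: "int mat \<Rightarrow> (nat, nat \<times> nat) pre_digraph" where
  "underlying_quiver B =
     \<lparr> verts = {0..<dim_row B},
       arcs = {(i, j). i < dim_row B \<and> j < dim_col B \<and> B $$ (i, j) > 0},
       tail = fst, head = snd \<rparr>"

text \<open>\<^const>\<open>Digraph_Component.connected\<close> is strong connectedness of the symmetrized
  digraph, i.e. connectedness of the underlying undirected graph; it requires at least one
  vertex, so the \<open>0 \<times> 0\<close> matrix is not connected.\<close>

definition connected_mat :: "int mat \<Rightarrow> bool" where
  "connected_mat B \<longleftrightarrow> Digraph_Component.connected (underlying_quiver B)"

text \<open>\<open>I\<close> and \<open>J\<close> are the sets of row and column indices
  \<open>{i\<^sub>1, \<dots>}\<close> and \<open>{j\<^sub>1, \<dots>}\<close>; the increasing enumeration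
  is the one built into \<^const>\<open>submatrix\<close>.\<close>

definition reducible_mat :: "int mat \<Rightarrow> bool" where
  "reducible_mat B \<longleftrightarrow>
     (\<exists>I J. I \<noteq> {} \<and> J \<noteq> {} \<and>
        (card J < dim_row B \<or> card I < dim_row B) \<and>
        (\<forall>b \<in> elements_mat (submatrix B I J). b \<ge> 0) \<and>
        I \<union> J = {0..<dim_row B} \<and> I \<inter> J = {})"

abbreviation irreducible_mat :: "int mat \<Rightarrow> bool" where
  "irreducible_mat B \<equiv> \<not> reducible_mat B"

end

theory Submission
  imports Defs
begin

text \<open>A partition into nonempty \<open>I\<close> and \<open>J\<close> for which the submatrix with rows \<open>I\<close>
  and columns \<open>J\<close> is nonnegative has, since \<open>b\<^sub>i\<^sub>j\<close> and \<open>b\<^sub>j\<^sub>i\<close> have opposite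
  signs, no arrow from \<open>J\<close> to \<open>I\<close>. So reducibility amounts to the existence of a nonempty proper
  set of vertices that is closed under successors, that is, to the failure of strong
  connectedness. An arrow lies in an oriented cycle iff its tail is reachable from its head, and if
  this holds for all arrows, then every undirected walk can be replaced by an oriented one.\<close>

context wf_digraph
begin

text \<open>Following a cycle onward from the end of \<open>e\<close> leads back to its start;
  conversely, \<open>e\<close> closes up any path from its head to its tail.\<close>

lemma in_cycle_iff_head_reaches_tail:
  assumes "e \<in> arcs G"
  shows "(\<exists>p. cycle p \<and> e \<in> set p) \<longleftrightarrow> head G e \<rightarrow>\<^sup>* tail G e"
proof
  assume "\<exists>p. cycle p \<and> e \<in> set p"
  then obtain u p where walk: "awalk u p u" and "e \<in> set p"
    unfolding cycle_def by blast
  then obtain q r where "p = q @ e # r"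
    by (auto simp: in_set_conv_decomp)
  \<comment> \<open>Cutting the closed walk at \<open>e\<close> leaves two pieces; \<open>r\<close>
    followed by \<open>q\<close> runs from the head of \<open>e\<close> through \<open>u\<close> to
    its tail.\<close>
  with walk have "awalk u q (tail G e)" "awalk (head G e) r u"
    by (auto simp: awalk_Cons_iff)
  then show "head G e \<rightarrow>\<^sup>* tail G e"
    by (meson reachable_awalkI reachable_trans)
next
  assume "head G e \<rightarrow>\<^sup>* tail G e"
  \<comment> \<open>A path is taken rather than a walk because \<open>cycle\<close> wants all
    vertices after the first to be distinct, and for \<open>e # q\<close> these are exactly the
    vertices of \<open>q\<close>.\<close>
  then obtain q where "apath (head G e) q (tail G e)"
    unfolding reachable_apath by blast
  with assms have "cycle (e # q)"
    unfolding cycle_def by (intro exI[of _ "tail G e"]) (auto simp: apath_def awalk_Cons_iff)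
  then show "\<exists>p. cycle p \<and> e \<in> set p"
    by (intro exI[of _ "e # q"]) simp
qed

lemma strongly_connected_iff_arcs_in_cycles:
  assumes "Digraph_Component.connected G"
  shows "strongly_connected G \<longleftrightarrow> (\<forall>e \<in> arcs G. \<exists>p. cycle p \<and> e \<in> set p)"
proof
  assume "strongly_connected G"
  then show "\<forall>e \<in> arcs G. \<exists>p. cycle p \<and> e \<in> set p"
    by (auto simp: in_cycle_iff_head_reaches_tail strongly_connected_def)
next
  assume "\<forall>e \<in> arcs G. \<exists>p. cycle p \<and> e \<in> set p"
  then have returns: "head G e \<rightarrow>\<^sup>* tail G e" if "e \<in> arcs G" for e
    using that by (simp add: in_cycle_iff_head_reaches_tail)
  interpret S: pair_wf_digraph "mk_symmetric G" ..
  have "u \<rightarrow>\<^sup>* v" if "u \<rightarrow>\<^sup>*\<^bsub>mk_symmetric G\<^esub> v" for u v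
    using that
  proof (induction rule: S.reachable_induct)
    case base
    then show ?case by simp
  next
    case (step x y)
    \<comment> \<open>The edge from \<open>x\<close> to \<open>y\<close> of the symmetrization is
      either an arc of \<open>G\<close> or the reverse of one; in the second case
      \<open>returns\<close> leads from \<open>x\<close> to \<open>y\<close>.\<close>
    then have "x \<rightarrow>\<^sup>* y"
      using returns by (fastforce simp: parcs_mk_symmetric dest: in_arcs_imp_in_arcs_ends)
    with step.IH show ?case
      by (rule reachable_trans)
  qed
  with assms show "strongly_connected G"
    by (auto simp: Digraph_Component.connected_def strongly_connected_def)
qed

text \<open>Directed walks cannot leave a set closed under successors.
  \<open>strongly_connected\<close> demands a vertex, whence the hypothesis: on the empty digraph
  the right side holds vacuously.\<close>

lemma strongly_connected_iff_no_closed_set: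
  assumes "verts G \<noteq> {}"
  shows "strongly_connected G \<longleftrightarrow>
    (\<nexists>J. J \<noteq> {} \<and> J \<subset> verts G \<and> (\<forall>e \<in> arcs G. tail G e \<in> J \<longrightarrow> head G e \<in> J))"
proof
  assume sc: "strongly_connected G"
  show "\<nexists>J. J \<noteq> {} \<and> J \<subset> verts G \<and> (\<forall>e \<in> arcs G. tail G e \<in> J \<longrightarrow> head G e \<in> J)"
  proof
    assume "\<exists>J. J \<noteq> {} \<and> J \<subset> verts G \<and> (\<forall>e \<in> arcs G. tail G e \<in> J \<longrightarrow> head G e \<in> J)"
    then obtain J u v where closed: "\<forall>e \<in> arcs G. tail G e \<in> J \<longrightarrow> head G e \<in> J"
      and "J \<subset> verts G" "u \<in> J" "v \<in> verts G" "v \<notin> J"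
      by blast
    with sc have "u \<rightarrow>\<^sup>* v"
      by (auto simp: strongly_connected_def)
    then have "v \<in> J"
      using \<open>u \<in> J\<close> closed by (induction rule: reachable_induct) auto
    with \<open>v \<notin> J\<close> show False ..
  qed
next
  assume none: "\<nexists>J. J \<noteq> {} \<and> J \<subset> verts G \<and> (\<forall>e \<in> arcs G. tail G e \<in> J \<longrightarrow> head G e \<in> J)"
  show "strongly_connected G"
  proof (rule strongly_connectedI[OF assms])
    fix u v assume "u \<in> verts G" "v \<in> verts G"
    \<comment> \<open>The vertices reachable from \<open>u\<close> form the smallest closed set
      containing \<open>u\<close>; it cannot be proper.\<close>
    let ?J = "{w. u \<rightarrow>\<^sup>* w}"
    have "?J \<noteq> {}" "?J \<subseteq> verts G"
      using \<open>u \<in> verts G\<close> by (auto dest: reachable_in_verts)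
    moreover have "\<forall>e \<in> arcs G. tail G e \<in> ?J \<longrightarrow> head G e \<in> ?J"
      unfolding mem_Collect_eq by (blast intro: reachable_adj_trans in_arcs_imp_in_arcs_ends)
    ultimately have "?J = verts G"
      using none by (metis (no_types, lifting) psubsetI)
    with \<open>v \<in> verts G\<close> show "u \<rightarrow>\<^sup>* v" by blast
  qed
qed

end

lemma wf_digraph_underlying_quiver:
  assumes "B \<in> carrier_mat n n"
  shows "wf_digraph (underlying_quiver B)"
  using assms by unfold_locales (auto simp: underlying_quiver_def)

text \<open>Skew-symmetry of \<open>S * B\<close> relates the two entries by the positive factors
  \<open>S $$ (i, i)\<close> and \<open>S $$ (j, j)\<close> and a minus sign. In this weak form, a
  nonnegative entry at \<open>(i, j)\<close> says precisely that there is no arrow from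
  \<open>j\<close> to \<open>i\<close>.\<close>

lemma skew_symmetrizable_mat_sign:
  assumes B: "B \<in> carrier_mat n n" and skew: "skew_symmetrizable_mat B"
    and "i < n" "j < n"
  shows "B $$ (i, j) \<ge> 0 \<longleftrightarrow> B $$ (j, i) \<le> 0"
proof -
  obtain S where S: "S \<in> carrier_mat n n" "diagonal_mat S" "\<forall>i < n. S $$ (i, i) > 0"
    and skew_SB: "skew_symmetric_mat (S * B)"
    using B skew by (auto simp: skew_symmetrizable_mat_def)
  have SB: "(S * B) $$ (k, l) = S $$ (k, k) * B $$ (k, l)" if "k < n" "l < n" for k l
  proof -
    have "(S * B) $$ (k, l) = (\<Sum>m\<in>{0..<n}. S $$ (k, m) * B $$ (m, l))"
      using B S(1) that by (simp add: scalar_prod_def)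
    also have "\<dots> = (\<Sum>m\<in>{0..<n}. if m = k then S $$ (k, k) * B $$ (k, l) else 0)"
      using S(1,2) that by (intro sum.cong) (auto simp: diagonal_mat_def)
    finally show ?thesis
      using that by simp
  qed
  have "transpose_mat (S * B) $$ (i, j) = (- (S * B)) $$ (i, j)"
    using skew_SB by (simp add: skew_symmetric_mat_def)
  then have eq: "S $$ (j, j) * B $$ (j, i) = - (S $$ (i, i) * B $$ (i, j))"
    using B S(1) SB \<open>i < n\<close> \<open>j < n\<close> by simp
  have pos: "S $$ (i, i) > 0" "S $$ (j, j) > 0"
    using S(3) \<open>i < n\<close> \<open>j < n\<close> by auto
  have "B $$ (i, j) \<ge> 0 \<longleftrightarrow> S $$ (i, i) * B $$ (i, j) \<ge> 0"
    using pos by (simp add: zero_le_mult_iff)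
  also have "\<dots> \<longleftrightarrow> S $$ (j, j) * B $$ (j, i) \<le> 0"
    unfolding eq by simp
  also have "\<dots> \<longleftrightarrow> B $$ (j, i) \<le> 0"
    using pos by (simp add: mult_le_0_iff)
  finally show ?thesis .
qed

text \<open>\<open>submatrix\<close> renumbers rows and columns through \<open>pick\<close>; this
  returns to the original indices, in which the sign condition of \<open>reducible_mat\<close> can
  be compared with arrows.\<close>

lemma elements_submatrix:
  assumes "I \<subseteq> {0..<dim_row A}" "J \<subseteq> {0..<dim_col A}"
  shows "elements_mat (submatrix A I J) = {A $$ (i, j) | i j. i \<in> I \<and> j \<in> J}"
proof -
  have I: "{i. i < dim_row A \<and> i \<in> I} = I" and J: "{j. j < dim_col A \<and> j \<in> J} = J"
    using assms by auto
  have "finite I" "finite J"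
    using assms by (auto intro: finite_subset)
  show ?thesis
  proof (intro equalityI subsetI)
    fix b assume "b \<in> elements_mat (submatrix A I J)"
    then obtain k l where "k < card I" "l < card J" "b = submatrix A I J $$ (k, l)"
      by (auto simp: dim_submatrix I J dest!: elements_matD)
    then have "b = A $$ (pick I k, pick J l)" "pick I k \<in> I" "pick J l \<in> J"
      by (simp_all add: submatrix_index I J pick_in_set)
    then show "b \<in> {A $$ (i, j) | i j. i \<in> I \<and> j \<in> J}"
      by blast
  next
    fix b assume "b \<in> {A $$ (i, j) | i j. i \<in> I \<and> j \<in> J}"
    then obtain i j where b: "b = A $$ (i, j)" and ij: "i \<in> I" "j \<in> J"
      by blast
    with assms have lt: "i < dim_row A" "j < dim_col A"
      by auto
    \<comment> \<open>The entry at \<open>(i, j)\<close> moves to the position that counts the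
      smaller elements of \<open>I\<close> and of \<open>J\<close>; strictness of the inclusions
      keeps this position in range.\<close>
    have "{a \<in> I. a < i} \<subset> I" "{a \<in> J. a < j} \<subset> J"
      using ij by auto
    then have "card {a \<in> I. a < i} < card I" "card {a \<in> J. a < j} < card J"
      using \<open>finite I\<close> \<open>finite J\<close> by (simp_all add: psubset_card_mono)
    then show "b \<in> elements_mat (submatrix A I J)"
      unfolding b submatrix_index_card[OF lt ij, symmetric]
      by (intro elements_matI[OF carrier_matI]) (simp_all add: dim_submatrix I J)
  qed
qed

lemma reducible_mat_iff_closed_set:
  assumes B: "B \<in> carrier_mat n n" and skew: "skew_symmetrizable_mat B"
  shows "reducible_mat B \<longleftrightarrow>
    (\<exists>J. J \<noteq> {} \<and> J \<subset> {0..<n} \<and> (\<forall>i j. j \<in> J \<and> i < n \<and> B $$ (j, i) > 0 \<longrightarrow> i \<in> J))"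
proof
  assume "reducible_mat B"
  then obtain I J where IJ: "I \<noteq> {}" "J \<noteq> {}" "I \<union> J = {0..<n}" "I \<inter> J = {}"
    and nonneg: "\<forall>b \<in> elements_mat (submatrix B I J). b \<ge> 0"
    using B by (auto simp: reducible_mat_def)
  have sub: "I \<subseteq> {0..<dim_row B}" "J \<subseteq> {0..<dim_col B}"
    using B IJ(3) by auto
  have "i \<in> J" if "j \<in> J" "i < n" "B $$ (j, i) > 0" for i j
  proof (rule ccontr)
    assume "i \<notin> J"
    moreover have "i \<in> I \<union> J"
      unfolding IJ(3) using \<open>i < n\<close> by simp
    ultimately have "i \<in> I" by blast
    with nonneg \<open>j \<in> J\<close> have "B $$ (i, j) \<ge> 0"
      unfolding elements_submatrix[OF sub] by blast
    moreover have "j < n"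
      using sub(2) B \<open>j \<in> J\<close> by auto
    ultimately show False
      using skew_symmetrizable_mat_sign[OF B skew \<open>i < n\<close> \<open>j < n\<close>] \<open>B $$ (j, i) > 0\<close> by simp
  qed
  moreover have "J \<subset> {0..<n}"
    using IJ by blast
  ultimately show "\<exists>J. J \<noteq> {} \<and> J \<subset> {0..<n} \<and> (\<forall>i j. j \<in> J \<and> i < n \<and> B $$ (j, i) > 0 \<longrightarrow> i \<in> J)"
    using IJ(2) by blast
next
  assume "\<exists>J. J \<noteq> {} \<and> J \<subset> {0..<n} \<and> (\<forall>i j. j \<in> J \<and> i < n \<and> B $$ (j, i) > 0 \<longrightarrow> i \<in> J)"
  then obtain J where J: "J \<noteq> {}" "J \<subset> {0..<n}"
    and closed: "\<And>i j. \<lbrakk>j \<in> J; i < n; B $$ (j, i) > 0\<rbrakk> \<Longrightarrow> i \<in> J"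
    by blast
  \<comment> \<open>The partition condition forces the row set to be the complement of
    \<open>J\<close>.\<close>
  let ?I = "{0..<n} - J"
  have sub: "?I \<subseteq> {0..<dim_row B}" "J \<subseteq> {0..<dim_col B}"
    using B J by auto
  have "B $$ (i, j) \<ge> 0" if "i \<in> ?I" "j \<in> J" for i j
  proof -
    have "i < n" "j < n" "\<not> B $$ (j, i) > 0"
      using that J closed by auto
    then show ?thesis
      using skew_symmetrizable_mat_sign[OF B skew \<open>i < n\<close> \<open>j < n\<close>] by simp
  qed
  \<comment> \<open>This makes the submatrix proper.\<close>
  moreover have "card J < n"
    using psubset_card_mono[OF _ J(2)] by simp
  ultimately show "reducible_mat B"
    unfolding reducible_mat_def
    by (intro exI[of _ ?I] exI[of _ J]) (use B J in \<open>auto simp: elements_submatrix[OF sub]\<close>)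
qed

theorem proposition4p2:
  fixes B :: "int mat" and n :: nat
  assumes "B \<in> carrier_mat n n"
    and "skew_symmetrizable_mat B"
    and "connected_mat B"
  shows "irreducible_mat B \<longleftrightarrow>
    (\<forall>a \<in> arcs (underlying_quiver B).
       \<exists>p. pre_digraph.cycle (underlying_quiver B) p \<and> a \<in> set p)"
proof -
  let ?Q = "underlying_quiver B"
  interpret wf_digraph ?Q
    using assms(1) by (rule wf_digraph_underlying_quiver)
  have conn: "Digraph_Component.connected ?Q"
    using assms(3) by (simp add: connected_mat_def)
  then have "verts ?Q \<noteq> {}"
    by (auto simp: Digraph_Component.connected_def strongly_connected_def)
  \<comment> \<open>The bound on \<open>J\<close> supplies \<open>j < n\<close>, which arcs require
    of their tail but the matrix condition does not state.\<close>
  moreover have "(\<forall>e \<in> arcs ?Q. tail ?Q e \<in> J \<longrightarrow> head ?Q e \<in> J) \<longleftrightarrow>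
      (\<forall>i j. j \<in> J \<and> i < n \<and> B $$ (j, i) > 0 \<longrightarrow> i \<in> J)" if "J \<subset> {0..<n}" for J
    using assms(1) that by (fastforce simp: underlying_quiver_def)
  moreover have "verts ?Q = {0..<n}"
    using assms(1) by (simp add: underlying_quiver_def)
  \<comment> \<open>\<open>conj_cong\<close> makes the bound on \<open>J\<close> available when the
    two closure conditions are exchanged under the quantifier.\<close>
  ultimately have "irreducible_mat B \<longleftrightarrow> strongly_connected ?Q"
    unfolding reducible_mat_iff_closed_set[OF assms(1,2)]
    by (simp add: strongly_connected_iff_no_closed_set cong: conj_cong)
  also have "\<dots> \<longleftrightarrow> (\<forall>a \<in> arcs ?Q. \<exists>p. cycle p \<and> a \<in> set p)"
    using conn by (rule strongly_connected_iff_arcs_in_cycles)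
  finally show ?thesis .
qed

end
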